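(* Let $(M,\in)$ be a countable model of ZFA. Let $\Gamma$ be its membership graph, ignoring multiple edges but keeping loops: the vertex set of $\Gamma$ is $M$, and for (not necessarily distinct) $x,y\in M$, $x$ is adjacent to $y$ if and only if $M\models x\in y$ or $M\models y\in x$ (so $x$ has a loop if and only if $M\models x\in x$). Then $\Gamma$ is isomorphic to the random loopy graph.
   Context: ZFA denotes the first-order theory obtained from ZFC (all objects being sets) by deleting the Axiom of Foundation and replacing it by the Anti-Foundation Axiom AFA. AFA states that every flat system of equations has a unique solution. A flat system of equations consists of a set $X$ of indeterminates, a set $A$ of sets called atoms (disjoint from $X$), and, for each $x\in X$, an equation $x=S_x$ with $S_x\subseteq X\cup A$ (the family $(S_x)_{x\in X}$ being itself a set). A solution is an assignment of sets to the indeterminates making all equations true, i.e. a function $s$ with domain $X$ such that $s(x)=\{s(y):y\in S_x\cap X\}\cup(S_x\cap A)$ for all $x\in X$. A loopy graph is an undirected graph without multiple edges in which loops are allowed, i.e. a set with a symmetric (not necessarily irreflexive) binary adjacency relation. The random loopy graph is the countable loopy graph obtained, up to isomorphism, with probability $1$ when edges (including loop edges) on a countably infinite vertex set are chosen independently with probability $1/2$ from all pairs of not necessarily distinct vertices. It is characterised, up to isomorphism, as the countable loopy graph such that, for any two finite disjoint sets $U$ and $V$ of vertices, there are vertices $z_1$ and $z_2$, where $z_1$ has no loop and $z_2$ has a loop, each joined to all vertices in $U$ and to no vertex in $V$. (Equivalently, it is the Fraïssé limit of the class of finite loopy graphs.) *)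

theory Defs
  imports "HOL-Probability.Probability"
begin

section \<open>First-order formulas in the language of set theory\<close>

datatype set_fm =
    Mem nat nat
  | Eql nat nat
  | Neg set_fm
  | Conj set_fm set_fm
  | Exi nat set_fm

primrec sat :: "'a set \<Rightarrow> ('a \<Rightarrow> 'a \<Rightarrow> bool) \<Rightarrow> (nat \<Rightarrow> 'a) \<Rightarrow> set_fm \<Rightarrow> bool" where
  "sat M E v (Mem i j) \<longleftrightarrow> E (v i) (v j)"
| "sat M E v (Eql i j) \<longleftrightarrow> v i = v j"
| "sat M E v (Neg \<phi>) \<longleftrightarrow> \<not> sat M E v \<phi>"
| "sat M E v (Conj \<phi> \<psi>) \<longleftrightarrow> sat M E v \<phi> \<and> sat M E v \<psi>"
| "sat M E v (Exi i \<phi>) \<longleftrightarrow> (\<exists>x\<in>M. sat M E (v(i := x)) \<phi>)"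


section \<open>Models of ZFA\<close>

text \<open>
  A structure for the language of set theory has domain \<open>M\<close> and membership relation \<open>E\<close>;
  \<open>E x y\<close> means that \<open>x\<close> is an element of \<open>y\<close> in the sense of the structure. All notions in this
  locale are the interpretations in \<open>(M, E)\<close> of first-order formulas, so every quantifier is
  restricted to \<open>M\<close>; in particular the pairs and functions are the internal (Kuratowski) ones.
\<close>

locale set_structure =
  fixes M :: "'a set" and E :: "'a \<Rightarrow> 'a \<Rightarrow> bool"
begin

definition is_empty :: "'a \<Rightarrow> bool" where
  "is_empty e \<longleftrightarrow> (\<forall>z\<in>M. \<not> E z e)"

definition subset_of :: "'a \<Rightarrow> 'a \<Rightarrow> bool" where
  "subset_of a b \<longleftrightarrow> (\<forall>z\<in>M. E z a \<longrightarrow> E z b)"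

definition is_succ :: "'a \<Rightarrow> 'a \<Rightarrow> bool" where
  "is_succ a s \<longleftrightarrow> (\<forall>z\<in>M. E z s \<longleftrightarrow> E z a \<or> z = a)"

definition is_upair :: "'a \<Rightarrow> 'a \<Rightarrow> 'a \<Rightarrow> bool" where
  "is_upair a b c \<longleftrightarrow> (\<forall>z\<in>M. E z c \<longleftrightarrow> z = a \<or> z = b)"

definition is_pair :: "'a \<Rightarrow> 'a \<Rightarrow> 'a \<Rightarrow> bool" where
  "is_pair a b p \<longleftrightarrow> (\<exists>u\<in>M. \<exists>w\<in>M. is_upair a a u \<and> is_upair a b w \<and> is_upair u w p)"

definition maps_to :: "'a \<Rightarrow> 'a \<Rightarrow> 'a \<Rightarrow> bool" where
  "maps_to f x y \<longleftrightarrow> (\<exists>p\<in>M. is_pair x y p \<and> E p f)"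

definition function_on :: "'a \<Rightarrow> 'a \<Rightarrow> bool" where
  "function_on X f \<longleftrightarrow>
     (\<forall>p\<in>M. E p f \<longrightarrow> (\<exists>x\<in>M. \<exists>y\<in>M. E x X \<and> is_pair x y p)) \<and>
     (\<forall>x\<in>M. E x X \<longrightarrow> (\<exists>!y. y \<in> M \<and> maps_to f x y))"

definition disjoint :: "'a \<Rightarrow> 'a \<Rightarrow> bool" where
  "disjoint a b \<longleftrightarrow> (\<forall>z\<in>M. \<not> (E z a \<and> E z b))"

text \<open>Indeterminates \<open>X\<close>, atoms \<open>A\<close>, and the family of right-hand sides given as a function
  \<open>S\<close> with domain \<open>X\<close>.\<close>

definition flat_system :: "'a \<Rightarrow> 'a \<Rightarrow> 'a \<Rightarrow> bool" where
  "flat_system X A S \<longleftrightarrow>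
     disjoint X A \<and> function_on X S \<and>
     (\<forall>x\<in>M. \<forall>T\<in>M. E x X \<and> maps_to S x T \<longrightarrow> (\<forall>z\<in>M. E z T \<longrightarrow> E z X \<or> E z A))"

definition solution :: "'a \<Rightarrow> 'a \<Rightarrow> 'a \<Rightarrow> 'a \<Rightarrow> bool" where
  "solution X A S s \<longleftrightarrow>
     function_on X s \<and>
     (\<forall>x\<in>M. \<forall>T\<in>M. \<forall>t\<in>M. E x X \<and> maps_to S x T \<and> maps_to s x t \<longrightarrow>
        (\<forall>z\<in>M. E z t \<longleftrightarrow>
           (\<exists>y\<in>M. E y T \<and> E y X \<and> maps_to s y z) \<or> (E z T \<and> E z A)))"

end

text \<open>
  In the schemes of separation and replacement, \<open>\<phi>\<close> ranges over all formulas; the assignment \<open>v\<close>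
  supplies the parameters. It is fixed before the set \<open>b\<close> is chosen, which renders the usual
  requirement that the variable for \<open>b\<close> is not free in \<open>\<phi>\<close>.
\<close>

locale ZFA_model = set_structure M E
  for M :: "'a set" and E :: "'a \<Rightarrow> 'a \<Rightarrow> bool" +
  assumes extensionality:
      "\<forall>a\<in>M. \<forall>b\<in>M. (\<forall>z\<in>M. E z a \<longleftrightarrow> E z b) \<longrightarrow> a = b"
    and pairing:
      "\<forall>a\<in>M. \<forall>b\<in>M. \<exists>c\<in>M. is_upair a b c"
    and union:
      "\<forall>a\<in>M. \<exists>u\<in>M. \<forall>z\<in>M. E z u \<longleftrightarrow> (\<exists>b\<in>M. E b a \<and> E z b)"
    and power_set:
      "\<forall>a\<in>M. \<exists>p\<in>M. \<forall>z\<in>M. E z p \<longleftrightarrow> subset_of z a"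
    and infinity:
      "\<exists>I\<in>M. (\<exists>e\<in>M. is_empty e \<and> E e I) \<and>
         (\<forall>x\<in>M. E x I \<longrightarrow> (\<exists>s\<in>M. is_succ x s \<and> E s I))"
    and separation:
      "\<forall>\<phi> v. range v \<subseteq> M \<longrightarrow>
         (\<forall>a\<in>M. \<exists>b\<in>M. \<forall>x\<in>M. E x b \<longleftrightarrow> E x a \<and> sat M E (v(0 := x)) \<phi>)"
    and replacement:
      "\<forall>\<phi> v. range v \<subseteq> M \<longrightarrow>
         (\<forall>a\<in>M.
           (\<forall>x\<in>M. E x a \<longrightarrow>
              (\<forall>y\<in>M. \<forall>y'\<in>M. sat M E (v(0 := x, 1 := y)) \<phi> \<and>
                 sat M E (v(0 := x, 1 := y')) \<phi> \<longrightarrow> y = y')) \<longrightarrow>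
           (\<exists>b\<in>M. \<forall>y\<in>M. E y b \<longleftrightarrow>
              (\<exists>x\<in>M. E x a \<and> sat M E (v(0 := x, 1 := y)) \<phi>)))"
    and choice:
      "\<forall>F\<in>M.
         (\<forall>a\<in>M. E a F \<longrightarrow> \<not> is_empty a) \<and>
         (\<forall>a\<in>M. \<forall>b\<in>M. E a F \<and> E b F \<and> a \<noteq> b \<longrightarrow> disjoint a b) \<longrightarrow>
         (\<exists>c\<in>M. \<forall>a\<in>M. E a F \<longrightarrow> (\<exists>!z. z \<in> M \<and> E z a \<and> E z c))"
    and anti_foundation:
      "\<forall>X\<in>M. \<forall>A\<in>M. \<forall>S\<in>M. flat_system X A S \<longrightarrow>
         (\<exists>!s. s \<in> M \<and> solution X A S s)"


section \<open>Loopy graphs\<close>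

record 'v lgraph =
  verts :: "'v set"
  adj :: "'v \<Rightarrow> 'v \<Rightarrow> bool"

definition loopy_graph :: "'v lgraph \<Rightarrow> bool" where
  "loopy_graph G \<longleftrightarrow> symp_on (verts G) (adj G)"

definition lgraph_iso :: "'v lgraph \<Rightarrow> 'w lgraph \<Rightarrow> bool" where
  "lgraph_iso G H \<longleftrightarrow>
     (\<exists>f. bij_betw f (verts G) (verts H) \<and>
          (\<forall>x\<in>verts G. \<forall>y\<in>verts G. adj G x y \<longleftrightarrow> adj H (f x) (f y)))"

definition membership_graph :: "'a set \<Rightarrow> ('a \<Rightarrow> 'a \<Rightarrow> bool) \<Rightarrow> 'a lgraph" where
  "membership_graph M E = \<lparr>verts = M, adj = (\<lambda>x y. E x y \<or> E y x)\<rparr>"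


section \<open>The random loopy graph\<close>

text \<open>The potential edges on the vertex set \<open>\<nat>\<close> are the unordered pairs \<open>{x, y}\<close>, the case
  \<open>x = y\<close> being the loops. Each is present independently with probability 1/2.\<close>

definition potential_edges :: "nat set set" where
  "potential_edges = {{x, y} | x y. True}"

definition coin_flips :: "(nat set \<Rightarrow> bool) measure" where
  "coin_flips = PiM potential_edges (\<lambda>_. measure_pmf (bernoulli_pmf (1/2)))"

definition graph_of_flips :: "(nat set \<Rightarrow> bool) \<Rightarrow> nat lgraph" where
  "graph_of_flips \<omega> = \<lparr>verts = UNIV, adj = (\<lambda>x y. \<omega> {x, y})\<rparr>"

text \<open>\<open>G\<close> is a copy of the random loopy graph: the countable loopy graph to which the above random
  graph is isomorphic with probability 1. By the last two lemmas below, this determines an isomorphism class.\<close>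

definition is_random_loopy_graph :: "'v lgraph \<Rightarrow> bool" where
  "is_random_loopy_graph G \<longleftrightarrow>
     loopy_graph G \<and> countable (verts G) \<and>
     (AE \<omega> in coin_flips. lgraph_iso G (graph_of_flips \<omega>))"

lemma lgraph_iso_sym:
  assumes "lgraph_iso G H"
  shows "lgraph_iso H G"
proof -
  obtain f where f: "bij_betw f (verts G) (verts H)"
    and adj: "\<And>x y. x \<in> verts G \<Longrightarrow> y \<in> verts G \<Longrightarrow> adj G x y \<longleftrightarrow> adj H (f x) (f y)"
    using assms unfolding lgraph_iso_def by blast
  let ?g = "inv_into (verts G) f"
  have g: "bij_betw ?g (verts H) (verts G)"
    by (rule bij_betw_inv_into[OF f])
  moreover have "adj H x y \<longleftrightarrow> adj G (?g x) (?g y)" if "x \<in> verts H" "y \<in> verts H" for x y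
    using adj[of "?g x" "?g y"] that bij_betw_inv_into_right[OF f] bij_betwE[OF g] by simp
  ultimately show ?thesis
    unfolding lgraph_iso_def by blast
qed

lemma lgraph_iso_trans:
  assumes "lgraph_iso G H" and "lgraph_iso H K"
  shows "lgraph_iso G K"
proof -
  obtain f where f: "bij_betw f (verts G) (verts H)"
    and adj_f: "\<And>x y. x \<in> verts G \<Longrightarrow> y \<in> verts G \<Longrightarrow> adj G x y \<longleftrightarrow> adj H (f x) (f y)"
    using assms(1) unfolding lgraph_iso_def by blast
  obtain g where g: "bij_betw g (verts H) (verts K)"
    and adj_g: "\<And>x y. x \<in> verts H \<Longrightarrow> y \<in> verts H \<Longrightarrow> adj H x y \<longleftrightarrow> adj K (g x) (g y)"
    using assms(2) unfolding lgraph_iso_def by blast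
  have "bij_betw (g \<circ> f) (verts G) (verts K)"
    by (rule bij_betw_trans[OF f g])
  moreover have "adj G x y \<longleftrightarrow> adj K ((g \<circ> f) x) ((g \<circ> f) y)"
    if "x \<in> verts G" "y \<in> verts G" for x y
    using adj_f adj_g bij_betwE[OF f] that by simp
  ultimately show ?thesis
    unfolding lgraph_iso_def by blast
qed

lemma random_loopy_graph_unique:
  assumes "is_random_loopy_graph G" and "is_random_loopy_graph H"
  shows "lgraph_iso G H"
proof -
  interpret prob_space coin_flips
    unfolding coin_flips_def by (intro prob_space_PiM measure_pmf.prob_space_axioms)
  have "AE \<omega> in coin_flips. lgraph_iso G (graph_of_flips \<omega>) \<and> lgraph_iso H (graph_of_flips \<omega>)"
    using assms unfolding is_random_loopy_graph_def by auto
  then have "AE \<omega> in coin_flips. lgraph_iso G H"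
    by (rule eventually_mono) (blast intro: lgraph_iso_trans lgraph_iso_sym)
  then show ?thesis
    by (cases "lgraph_iso G H") (simp_all add: AE_False)
qed

lemma random_loopy_graph_iso_invariant:
  assumes "is_random_loopy_graph G" and "loopy_graph H" and "lgraph_iso G H"
  shows "is_random_loopy_graph H"
proof -
  have "countable (verts H)"
    using assms countable_image unfolding is_random_loopy_graph_def lgraph_iso_def bij_betw_def
    by metis
  moreover have "AE \<omega> in coin_flips. lgraph_iso H (graph_of_flips \<omega>)"
    using assms(1) unfolding is_random_loopy_graph_def
    by (auto intro: lgraph_iso_trans[OF lgraph_iso_sym[OF assms(3)]])
  ultimately show ?thesis
    using assms(2) unfolding is_random_loopy_graph_def by blast
qed

end

theory Submission
  imports Defs
begin

text \<open>
  Given finite disjoint sets \<open>U\<close>, \<open>V\<close> of elements of the model, choose a set \<open>c\<close> that is not a member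
  of itself and lies in neither \<open>U \<union> V\<close>, its union, nor the union of its union; a Russell set provides one.
  Then \<open>z = U \<union> {c}\<close> has no loop, the solution of \<open>z = {z} \<union> U \<union> {c}\<close> given by AFA has a loop, and
  since \<open>c \<in> z\<close> neither of them equals, or is a member of, any set in \<open>U \<union> V\<close>. So the membership
  graph has the extension property, which the coin-flip graph has almost surely, and back and forth
  shows that any two countable graphs with this property are isomorphic.
\<close>

section \<open>The extension property and back and forth\<close>

text \<open>The Boolean \<open>l\<close> covers the looped and the loopless witness at once. Placing
  \<open>z\<close> outside \<open>U \<union> V\<close> makes it a fresh vertex for back and
  forth.\<close>

definition extension_property :: "'v lgraph \<Rightarrow> bool" where
  "extension_property G \<longleftrightarrow>
     (\<forall>U V l. finite U \<and> finite V \<and> U \<subseteq> verts G \<and> V \<subseteq> verts G \<and> U \<inter> V = {} \<longrightarrow>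
        (\<exists>z\<in>verts G - (U \<union> V).
           adj G z z = l \<and> (\<forall>u\<in>U. adj G z u) \<and> (\<forall>v\<in>V. \<not> adj G z v)))"

text \<open>A relation rather than a function, so that exchanging the graphs is taking the converse;
  \<open>a = a' \<longleftrightarrow> b = b'\<close> says single-valued and injective
  together.\<close>

definition partial_iso :: "'v lgraph \<Rightarrow> 'w lgraph \<Rightarrow> ('v \<times> 'w) set \<Rightarrow> bool" where
  "partial_iso G H P \<longleftrightarrow>
     P \<subseteq> verts G \<times> verts H \<and>
     (\<forall>a b a' b'. (a, b) \<in> P \<longrightarrow> (a', b') \<in> P \<longrightarrow>
        (a = a' \<longleftrightarrow> b = b') \<and> (adj G a a' \<longleftrightarrow> adj H b b'))"

lemma partial_isoD:
  assumes "partial_iso G H P" "(a, b) \<in> P" "(a', b') \<in> P"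
  shows "a = a' \<longleftrightarrow> b = b'" "adj G a a' \<longleftrightarrow> adj H b b'"
  using assms unfolding partial_iso_def by simp_all

lemma partial_iso_converse: "partial_iso G H P \<Longrightarrow> partial_iso H G (P\<inverse>)"
  unfolding partial_iso_def by auto

text \<open>A new vertex \<open>a\<close> is sent to a witness for the images \<open>U\<close> of
  its neighbours and \<open>V\<close> of its non-neighbours, with the loop status of
  \<open>a\<close>.\<close>

lemma partial_iso_forth:
  assumes "loopy_graph G" "loopy_graph H" and ext: "extension_property H"
    and P: "partial_iso G H P" "finite P" and a: "a \<in> verts G"
  shows "\<exists>P'. partial_iso G H P' \<and> finite P' \<and> P \<subseteq> P' \<and> a \<in> Domain P'"
proof (cases "a \<in> Domain P")
  case True
  then show ?thesis using P by blast
next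
  case False
  define U where "U = {b. \<exists>a'. (a', b) \<in> P \<and> adj G a a'}"
  define V where "V = {b. \<exists>a'. (a', b) \<in> P \<and> \<not> adj G a a'}"
  have PP: "P \<subseteq> verts G \<times> verts H" using P(1) unfolding partial_iso_def by blast
  note inj = partial_isoD(1)[OF P(1)] and ad = partial_isoD(2)[OF P(1)]
  have sub: "U \<subseteq> Range P" "V \<subseteq> Range P" unfolding U_def V_def by auto
  then have "finite U" "finite V" using finite_Range[OF P(2)] finite_subset by blast+
  moreover have "U \<subseteq> verts H" "V \<subseteq> verts H" using sub PP by blast+
  moreover have "U \<inter> V = {}" unfolding U_def V_def using inj by blast
  ultimately obtain z where z: "z \<in> verts H - (U \<union> V)" "adj H z z = adj G a a"
    "\<forall>u\<in>U. adj H z u" "\<forall>v\<in>V. \<not> adj H z v"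
    using ext[unfolded extension_property_def, rule_format, of U V "adj G a a"] by auto
  \<comment> \<open>Every image already in use lies in \<open>U \<union> V\<close>, so avoiding that
    set makes \<open>z\<close> new.\<close>
  have new: "adj G a a' \<longleftrightarrow> adj H z b" "b \<noteq> z" "a' \<noteq> a" if "(a', b) \<in> P" for a' b
  proof -
    have "b \<in> U \<longleftrightarrow> adj G a a'" "b \<in> U \<union> V"
      using that inj unfolding U_def V_def by auto
    then show "adj G a a' \<longleftrightarrow> adj H z b" "b \<noteq> z" using z by auto
    show "a' \<noteq> a" using that False by auto
  qed
  \<comment> \<open>The witness controls adjacency from \<open>z\<close>; symmetry of both graphs
    gives the other order.\<close>
  have new': "adj G a' a \<longleftrightarrow> adj H b z" if "(a', b) \<in> P" for a' b
  proof -
    have "a' \<in> verts G" "b \<in> verts H" using that PP by auto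
    then have "adj G a' a = adj G a a'" "adj H b z = adj H z b"
      using assms(1,2) a z(1) unfolding loopy_graph_def symp_on_def by auto
    then show ?thesis using new(1)[OF that] by simp
  qed
  have "(x = x' \<longleftrightarrow> y = y') \<and> (adj G x x' \<longleftrightarrow> adj H y y')"
    if "(x, y) \<in> insert (a, z) P" "(x', y') \<in> insert (a, z) P" for x y x' y'
  proof (cases "(x, y) \<in> P"; cases "(x', y') \<in> P")
    assume "(x, y) \<in> P" "(x', y') \<in> P"
    then show ?thesis by (simp add: inj ad)
  next
    assume "(x, y) \<in> P" "(x', y') \<notin> P"
    then show ?thesis using new[of x y] new'[of x y] that by simp
  next
    assume "(x, y) \<notin> P" "(x', y') \<in> P"
    then show ?thesis using new[of x' y'] that by auto
  next
    assume "(x, y) \<notin> P" "(x', y') \<notin> P"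
    then show ?thesis using z(2) that by simp
  qed
  then have "partial_iso G H (insert (a, z) P)"
    using PP a z(1) unfolding partial_iso_def by auto
  then show ?thesis using P(2) by (intro exI[of _ "insert (a, z) P"]) auto
qed

lemma partial_iso_back:
  assumes "loopy_graph G" "loopy_graph H" and "extension_property G"
    and P: "partial_iso G H P" "finite P" and b: "b \<in> verts H"
  shows "\<exists>P'. partial_iso G H P' \<and> finite P' \<and> P \<subseteq> P' \<and> b \<in> Range P'"
proof -
  obtain Q where "partial_iso H G Q" "finite Q" "P\<inverse> \<subseteq> Q" "b \<in> Domain Q"
    using partial_iso_forth[OF assms(2,1,3) partial_iso_converse[OF P(1)] _ b] P(2) by auto
  then show ?thesis
    by (intro exI[of _ "Q\<inverse>"]) (auto intro: partial_iso_converse)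
qed

lemma extension_property_nonempty: "extension_property G \<Longrightarrow> verts G \<noteq> {}"
  using extension_property_def[THEN iffD1, rule_format, of G "{}" "{}"] by auto

text \<open>The union of an increasing chain of finite partial isomorphisms is an isomorphism when
  stage \<open>n\<close> takes care of the \<open>n\<close>th vertex of each graph.\<close>

lemma extension_property_iso:
  assumes G: "loopy_graph G" "countable (verts G)" "extension_property G"
    and H: "loopy_graph H" "countable (verts H)" "extension_property H"
  shows "lgraph_iso G H"
proof -
  \<comment> \<open>These enumerations may repeat; only surjectivity matters. Nonemptiness comes
    from the extension property for \<open>U = V = {}\<close>.\<close>
  define g where "g = from_nat_into (verts G)"
  define h where "h = from_nat_into (verts H)"
  have rg: "range g = verts G" and rh: "range h = verts H"
    unfolding g_def h_def
    by (simp_all add: G H extension_property_nonempty range_from_nat_into)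
  define ok where "ok P \<longleftrightarrow> partial_iso G H P \<and> finite P" for P
  have step: "\<exists>P'. ok P' \<and> P \<subseteq> P' \<and> g n \<in> Domain P' \<and> h n \<in> Range P'" if P: "ok P" for P n
  proof -
    have gn: "g n \<in> verts G" and hn: "h n \<in> verts H" using rg rh by blast+
    obtain Q where Q: "ok Q" "P \<subseteq> Q" "g n \<in> Domain Q"
      using partial_iso_forth[OF G(1) H(1,3), of P "g n"] P gn unfolding ok_def by auto
    obtain R where "ok R" "Q \<subseteq> R" "h n \<in> Range R"
      using partial_iso_back[OF G(1) H(1) G(3), of Q "h n"] Q(1) hn unfolding ok_def by auto
    then show ?thesis using Q by blast
  qed
  have "ok {}" unfolding ok_def partial_iso_def by simp
  then obtain P where P: "\<And>n. ok (P n)"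
    and Suc: "\<And>n. P n \<subseteq> P (Suc n) \<and> g n \<in> Domain (P (Suc n)) \<and> h n \<in> Range (P (Suc n))"
    using dependent_nat_choice[of "\<lambda>_ P. ok P"
        "\<lambda>n P P'. P \<subseteq> P' \<and> g n \<in> Domain P' \<and> h n \<in> Range P'"] step by metis
  have mono: "P m \<subseteq> P n" if "m \<le> n" for m n
    using lift_Suc_mono_le[of P, OF _ that] Suc by blast
  define R where "R = (\<Union>n. P n)"
  have R: "(a = a' \<longleftrightarrow> b = b') \<and> (adj G a a' \<longleftrightarrow> adj H b b')"
    if in_R: "(a, b) \<in> R" "(a', b') \<in> R" for a b a' b'
  proof -
    obtain m n where "(a, b) \<in> P m" "(a', b') \<in> P n" using in_R unfolding R_def by blast
    then have "(a, b) \<in> P (max m n)" "(a', b') \<in> P (max m n)"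
      using mono[of m "max m n"] mono[of n "max m n"] by auto
    then show ?thesis
      using P[of "max m n"] partial_isoD[of G H "P (max m n)" a b a' b'] unfolding ok_def by simp
  qed
  have sub: "R \<subseteq> verts G \<times> verts H"
    using P unfolding R_def ok_def partial_iso_def by blast
  have dom: "\<exists>b. (a, b) \<in> R" if "a \<in> verts G" for a
    using that Suc unfolding R_def rg[symmetric] by blast
  have ran: "\<exists>a. (a, b) \<in> R" if "b \<in> verts H" for b
    using that Suc unfolding R_def rh[symmetric] by blast
  obtain f where f: "\<And>a. a \<in> verts G \<Longrightarrow> (a, f a) \<in> R" using dom by metis
  have "bij_betw f (verts G) (verts H)"
  proof (rule bij_betw_imageI)
    show "inj_on f (verts G)" using f R by (metis inj_onI)
    show "f ` verts G = verts H"
    proof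
      show "f ` verts G \<subseteq> verts H" using f sub by blast
      show "verts H \<subseteq> f ` verts G"
      proof
        fix b assume "b \<in> verts H"
        then obtain a where "(a, b) \<in> R" using ran by blast
        moreover then have "a \<in> verts G" using sub by blast
        ultimately show "b \<in> f ` verts G" using f R by blast
      qed
    qed
  qed
  then show ?thesis unfolding lgraph_iso_def using f R by blast
qed

section \<open>Almost sure extension property of the coin-flip graph\<close>

text \<open>Independent trials, each succeeding with probability at least \<open>p\<close>, fail
  \<open>n\<close> times in a row with probability at most \<open>(1 - p) ^ n\<close>, which tends
  to 0.\<close>

lemma (in prob_space) AE_exists_indep_vars:
  assumes ind: "indep_vars N X I" and "infinite I"
    and A: "\<And>i. i \<in> I \<Longrightarrow> A i \<in> sets (N i)"
    and p: "p > 0" "\<And>i. i \<in> I \<Longrightarrow> p \<le> prob (X i -` A i \<inter> space M)"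
  shows "AE \<omega> in M. \<exists>i\<in>I. X i \<omega> \<in> A i"
proof -
  obtain f :: "nat \<Rightarrow> _" where f: "inj f" "range f \<subseteq> I"
    using infinite_countable_subset[OF \<open>infinite I\<close>] by blast
  then have fI: "f n \<in> I" for n by blast
  have X: "X i \<in> measurable M (N i)" if "i \<in> I" for i
    using ind that unfolding indep_vars_def by blast
  define C where "C i = X i -` (space (N i) - A i) \<inter> space M" for i
  have C_sets: "C i \<in> events" if "i \<in> I" for i
    unfolding C_def using X[OF that] A[OF that] by measurable
  have C_prob: "prob (C i) \<le> 1 - p" if "i \<in> I" for i
  proof -
    have "C i = space M - (X i -` A i \<inter> space M)"
      unfolding C_def using measurable_space[OF X[OF that]] by auto
    then show ?thesis
      using p(2)[OF that] prob_compl[OF measurable_sets[OF X[OF that] A[OF that]]] by simp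
  qed
  define B where "B = (\<Inter>n. C (f n))"
  have B: "B \<in> events" unfolding B_def using C_sets fI by blast
  have "prob B \<le> (1 - p) ^ n" for n
  \<comment> \<open>For \<open>n = 0\<close> the bound is 1; the product rule for independence needs
    a nonempty index set.\<close>
  proof (cases "n = 0")
    case False
    have "prob B \<le> prob (\<Inter>i\<in>f ` {..<n}. C i)"
      unfolding B_def using C_sets fI False by (intro finite_measure_mono sets.finite_INT) auto
    also have "\<dots> = (\<Prod>i\<in>f ` {..<n}. prob (C i))"
      unfolding C_def using fI False A by (intro indep_varsD[OF ind]) auto
    also have "\<dots> \<le> (\<Prod>i\<in>f ` {..<n}. 1 - p)"
      using C_prob fI by (intro prod_mono) auto
    also have "\<dots> = (1 - p) ^ n"
      using f(1) by (simp add: card_image inj_on_subset)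
    finally show ?thesis .
  qed simp
  moreover have "0 \<le> 1 - p" using C_prob[OF fI[of 0]] measure_nonneg[of M "C (f 0)"] by linarith
  then have "(\<lambda>n. (1 - p) ^ n) \<longlonglongrightarrow> 0" using p(1) by (intro LIMSEQ_power_zero) auto
  ultimately have "prob B \<le> 0" by (intro LIMSEQ_le_const) auto
  then have "prob B = 0" using measure_nonneg[of M B] by linarith
  then have "AE \<omega> in M. \<omega> \<notin> B" using prob_eq_0[OF B] by blast
  then show ?thesis
  proof (rule AE_mp, intro AE_I2 impI)
    fix \<omega> assume "\<omega> \<in> space M" "\<omega> \<notin> B"
    then show "\<exists>i\<in>I. X i \<omega> \<in> A i"
      unfolding B_def C_def using fI measurable_space[OF X[OF fI]] by blast
  qed
qed

text \<open>Independence means that the joint law is the product of the marginals; the joint map is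
  the identity on the space, so its law is the product measure itself.\<close>

lemma (in product_prob_space) indep_vars_PiM_components:
  assumes "I \<noteq> {}"
  shows "P.indep_vars M (\<lambda>i \<omega>. \<omega> i) I"
proof (subst P.indep_vars_iff_distr_eq_PiM')
  have "distr (PiM I M) (PiM I M) (\<lambda>x. \<lambda>i\<in>I. x i) = distr (PiM I M) (PiM I M) (\<lambda>x. x)"
    by (rule distr_cong) (auto simp: space_PiM PiE_restrict)
  also have "\<dots> = PiM I (\<lambda>i. distr (PiM I M) (M i) (\<lambda>\<omega>. \<omega> i))"
    by (simp add: PiM_component cong: PiM_cong)
  finally show "distr (PiM I M) (PiM I M) (\<lambda>x. \<lambda>i\<in>I. x i) = PiM I (\<lambda>i. distr (PiM I M) (M i) (\<lambda>\<omega>. \<omega> i))" .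
qed (use assms in auto)

text \<open>For fixed \<open>U\<close>, \<open>V\<close>, \<open>l\<close>, distinct candidates
  \<open>z\<close> are tested by disjoint sets of edges, hence independently, with the same positive
  success probability. There are countably many such triples.\<close>

lemma graph_of_flips_extension:
  "AE \<omega> in coin_flips. extension_property (graph_of_flips \<omega>)"
proof -
  interpret product_prob_space "\<lambda>_. measure_pmf (bernoulli_pmf (1/2))" potential_edges
    by unfold_locales
  have "AE \<omega> in coin_flips. \<exists>z\<in>- (U \<union> V).
           (\<omega> {z} \<longleftrightarrow> l) \<and> (\<forall>u\<in>U. \<omega> {z, u}) \<and> (\<forall>v\<in>V. \<not> \<omega> {z, v})"
    if fin: "finite U" "finite V" and disj: "U \<inter> V = {}" for U V l
  proof -
    \<comment> \<open>The edges from \<open>z\<close> to itself and to \<open>U \<union> V\<close>,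
      the loop being \<open>{z, z} = {z}\<close>. For distinct \<open>z\<close> outside
      \<open>U \<union> V\<close> these sets do not meet.\<close>
    define K where "K z = (\<lambda>x. {z, x}) ` insert z (U \<union> V)" for z
    define I where "I = - (U \<union> V)"
    \<comment> \<open>The default is false, which is right for edges to \<open>V\<close> because
      \<open>V\<close> misses \<open>U\<close>.\<close>
    define val where "val z e \<longleftrightarrow> (if e = {z} then l else \<exists>u\<in>U. e = {z, u})" for z e
    have K: "K z \<subseteq> potential_edges" "finite (K z)" for z
      unfolding K_def potential_edges_def using fin by auto
    have disjK: "disjoint_family_on K I"
      unfolding disjoint_family_on_def K_def I_def by (auto simp: doubleton_eq_iff)
    have ne: "potential_edges \<noteq> {}" unfolding potential_edges_def by blast
    let ?N = "\<lambda>_ :: nat set. measure_pmf (bernoulli_pmf (1/2))"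
    let ?P = "PiM potential_edges ?N"
    let ?X = "\<lambda>z \<omega>. restrict (\<lambda>e. \<omega> e) (K z)"
    let ?A = "\<lambda>z. PiE (K z) (\<lambda>e. {val z e})"
    have ind: "P.indep_vars (\<lambda>z. PiM (K z) ?N) ?X I"
      by (rule P.indep_vars_restrict[OF indep_vars_PiM_components[OF ne] K(1) disjK])
    have "AE \<omega> in coin_flips. \<exists>z\<in>I. ?X z \<omega> \<in> ?A z"
      unfolding coin_flips_def
    proof (rule P.AE_exists_indep_vars[OF ind])
      show "infinite I" unfolding I_def using fin by (simp add: Compl_eq_Diff_UNIV infinite_UNIV_nat)
      show "?A z \<in> sets (PiM (K z) ?N)" for z
        using K(2) by (intro sets_PiM_I_finite) auto
      show "(0::real) < (1/2) ^ Suc (card (U \<union> V))" by simp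
      fix z assume "z \<in> I"
      \<comment> \<open>A finite cylinder, whose measure is a product over
        \<open>K z\<close>.\<close>
      have "?X z -` ?A z \<inter> space ?P = emb potential_edges (K z) (?A z)"
        unfolding prod_emb_def by (auto simp: space_PiM)
      then have "P.prob (?X z -` ?A z \<inter> space ?P) =
          (\<Prod>e\<in>K z. measure_pmf.prob (bernoulli_pmf (1/2)) {val z e})"
        using measure_PiM_emb[OF K] by simp
      also have "\<dots> = (1/2) ^ card (K z)"
        by (simp add: measure_pmf_single pmf_bernoulli_half)
      also have "card (K z) = Suc (card (U \<union> V))"
        using \<open>z \<in> I\<close> fin unfolding K_def I_def
        by (subst card_image) (auto simp: inj_on_def doubleton_eq_iff)
      finally show "(1/2) ^ Suc (card (U \<union> V)) \<le> P.prob (?X z -` ?A z \<inter> space ?P)"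
        by (rule eq_refl[OF sym])
    qed
    then show ?thesis
    proof (rule AE_mp, intro AE_I2 impI)
      fix \<omega> assume "\<exists>z\<in>I. ?X z \<omega> \<in> ?A z"
      then obtain z where z: "z \<in> I" "\<And>e. e \<in> K z \<Longrightarrow> \<omega> e = val z e"
        by (auto simp: PiE_iff)
      have "\<omega> {z} = val z {z}" by (rule z(2)) (auto simp: K_def)
      moreover have "\<omega> {z, x} = val z {z, x}" if "x \<in> U \<union> V" for x
        using that by (intro z(2)) (auto simp: K_def)
      ultimately show "\<exists>z\<in>- (U \<union> V).
           (\<omega> {z} \<longleftrightarrow> l) \<and> (\<forall>u\<in>U. \<omega> {z, u}) \<and> (\<forall>v\<in>V. \<not> \<omega> {z, v})"
        using z(1) disj unfolding val_def I_def
        by (intro bexI[of _ z]) (auto simp: doubleton_eq_iff)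
    qed
  qed
  \<comment> \<open>Finite sets of naturals are countably many, so the exceptional null sets can be
    merged.\<close>
  then have "AE \<omega> in coin_flips. \<forall>(U, V)\<in>{(U, V). finite U \<and> finite V}. \<forall>l. U \<inter> V = {} \<longrightarrow>
       (\<exists>z\<in>- (U \<union> V). (\<omega> {z} \<longleftrightarrow> l) \<and> (\<forall>u\<in>U. \<omega> {z, u}) \<and> (\<forall>v\<in>V. \<not> \<omega> {z, v}))"
    by (subst AE_ball_countable)
      (auto simp: AE_all_countable Collect_case_prod_Sigma[of "finite" "\<lambda>_. finite"]
        countable_Collect_finite intro!: AE_impI)
  then show ?thesis
    by (rule AE_mp, intro AE_I2 impI)
      (auto simp: extension_property_def graph_of_flips_def Compl_eq_Diff_UNIV)
qed

section \<open>Sets in a model of ZFA\<close>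

context ZFA_model
begin

text \<open>Let \<open>c\<close> consist of the members of \<open>a\<close> that are not members of
  themselves: \<open>E c c\<close> refutes itself, and \<open>E c a\<close> would then put
  \<open>c\<close> into \<open>c\<close>.\<close>

lemma Russell:
  assumes "a \<in> M"
  shows "\<exists>c\<in>M. \<not> E c a \<and> \<not> E c c"
proof -
  have "\<exists>c\<in>M. \<forall>x\<in>M. E x c \<longleftrightarrow> E x a \<and> sat M E ((\<lambda>_. a)(0 := x)) (Neg (Mem 0 0))"
    using separation[rule_format, of "\<lambda>_. a" a] assms by blast
  then show ?thesis by auto
qed

lemma empty_exists: "\<exists>e\<in>M. \<forall>z\<in>M. \<not> E z e"
  using infinity unfolding is_empty_def by blast

lemma singleton_exists: "a \<in> M \<Longrightarrow> \<exists>c\<in>M. \<forall>z\<in>M. E z c \<longleftrightarrow> z = a"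
  using pairing unfolding is_upair_def by blast

lemma union_exists: "a \<in> M \<Longrightarrow> \<exists>u\<in>M. \<forall>z\<in>M. E z u \<longleftrightarrow> (\<exists>b\<in>M. E b a \<and> E z b)"
  using union by (rule bspec)

lemma binary_union:
  assumes "a \<in> M" "b \<in> M"
  shows "\<exists>c\<in>M. \<forall>z\<in>M. E z c \<longleftrightarrow> E z a \<or> E z b"
proof -
  obtain p where p: "p \<in> M" "\<And>z. z \<in> M \<Longrightarrow> E z p \<longleftrightarrow> z = a \<or> z = b"
    using pairing[rule_format, OF assms] unfolding is_upair_def by auto
  obtain u where "u \<in> M" "\<forall>z\<in>M. E z u \<longleftrightarrow> (\<exists>b\<in>M. E b p \<and> E z b)"
    using union_exists[OF p(1)] by blast
  then show ?thesis using assms p(2) by (intro bexI[of _ u]) auto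
qed

lemma insert_exists:
  assumes "a \<in> M" "b \<in> M"
  shows "\<exists>c\<in>M. \<forall>z\<in>M. E z c \<longleftrightarrow> z = a \<or> E z b"
proof -
  obtain s where "s \<in> M" "\<forall>z\<in>M. E z s \<longleftrightarrow> z = a" using singleton_exists[OF assms(1)] by blast
  then show ?thesis using binary_union[of s b] assms(2) by auto
qed

lemma finite_set_exists:
  assumes "finite U" "U \<subseteq> M"
  shows "\<exists>c\<in>M. \<forall>z\<in>M. E z c \<longleftrightarrow> z \<in> U"
  using assms
proof (induction rule: finite_induct)
  case empty
  then show ?case using empty_exists by simp
next
  case (insert x F)
  then obtain c where "c \<in> M" "\<forall>z\<in>M. E z c \<longleftrightarrow> z \<in> F" by blast
  then show ?case using insert_exists[of x c] insert.prems by auto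
qed

lemma pair_exists: "a \<in> M \<Longrightarrow> b \<in> M \<Longrightarrow> \<exists>p\<in>M. is_pair a b p"
  unfolding is_pair_def using pairing by meson

lemma pair_inject:
  assumes "is_pair a b p" "is_pair a' b' p" and M: "a \<in> M" "b \<in> M" "a' \<in> M" "b' \<in> M"
  shows "a = a' \<and> b = b'"
proof -
  obtain u w where uw: "u \<in> M" "w \<in> M" "is_upair a a u" "is_upair a b w" "is_upair u w p"
    using assms(1) unfolding is_pair_def by blast
  obtain u' w' where uw': "u' \<in> M" "w' \<in> M" "is_upair a' a' u'" "is_upair a' b' w'" "is_upair u' w' p"
    using assms(2) unfolding is_pair_def by blast
  \<comment> \<open>The components may match crosswise; the singletons then force all four entries
    to coincide.\<close>
  have "(u = u' \<and> w = w') \<or> (u = w' \<and> w = u')"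
    using uw(1,2,5) uw'(1,2,5) unfolding is_upair_def by metis
  then show ?thesis
    using uw(3,4) uw'(3,4) M unfolding is_upair_def by metis
qed

text \<open>The set is the value at \<open>x\<close> of the solution of the one-equation flat system
  \<open>x = {x} \<union> A\<close> with atoms \<open>A\<close>.\<close>

lemma self_member_exists:
  assumes A: "A \<in> M"
  shows "\<exists>z\<in>M. \<forall>y\<in>M. E y z \<longleftrightarrow> y = z \<or> E y A"
proof -
  \<comment> \<open>Indeterminates and atoms must be disjoint, so \<open>x\<close> is taken outside
    \<open>A\<close>.\<close>
  obtain x where x: "x \<in> M" "\<not> E x A" using Russell[OF A] by blast
  obtain X where X: "X \<in> M" "\<And>z. z \<in> M \<Longrightarrow> E z X \<longleftrightarrow> z = x" using singleton_exists[OF x(1)] by blast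
  obtain T where T: "T \<in> M" "\<And>z. z \<in> M \<Longrightarrow> E z T \<longleftrightarrow> z = x \<or> E z A"
    using insert_exists[OF x(1) A] by blast
  obtain p where p: "p \<in> M" "is_pair x T p" using pair_exists x(1) T(1) by blast
  obtain S where S: "S \<in> M" "\<And>z. z \<in> M \<Longrightarrow> E z S \<longleftrightarrow> z = p" using singleton_exists[OF p(1)] by blast
  have S_maps: "maps_to S x y \<longleftrightarrow> y = T" if "y \<in> M" for y
    unfolding maps_to_def using S(2) p pair_inject[OF p(2)] that x(1) T(1) by blast
  have "function_on X S"
    unfolding function_on_def using S X p x(1) T(1) S_maps by auto
  then have "flat_system X A S"
    unfolding flat_system_def disjoint_def using X(2) T x S_maps by auto
  then obtain s where s: "s \<in> M" "solution X A S s"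
    using anti_foundation X(1) A S(1) by blast
  then obtain z where z: "z \<in> M" "maps_to s x z" "\<And>y. y \<in> M \<Longrightarrow> maps_to s x y \<Longrightarrow> y = z"
    unfolding solution_def function_on_def using X(2) x(1) by metis
  \<comment> \<open>In the right-hand side \<open>T\<close> the only indeterminate \<open>x\<close>
    is replaced by its value \<open>z\<close>, while the members of \<open>A\<close> stay.\<close>
  have "\<forall>y\<in>M. E y z \<longleftrightarrow> (\<exists>y'\<in>M. E y' T \<and> E y' X \<and> maps_to s y' y) \<or> (E y T \<and> E y A)"
    using s(2) x(1) T(1) z(1,2) X(2) S_maps unfolding solution_def by blast
  then have "\<forall>y\<in>M. E y z \<longleftrightarrow> y = z \<or> E y A"
    using X(2) T(2) x z by metis
  then show ?thesis using z(1) by blast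
qed

section \<open>Extension property of the membership graph\<close>

lemma membership_graph_extension:
  "extension_property (membership_graph M E)"
  unfolding extension_property_def membership_graph_def lgraph.simps
proof (intro allI impI, elim conjE)
  fix U V :: "'a set" and l :: bool
  assume fin: "finite U" "finite V" and sub: "U \<subseteq> M" "V \<subseteq> M" and disj: "U \<inter> V = {}"
  \<comment> \<open>\<open>D\<close> will collect three levels: the elements of
    \<open>U \<union> V\<close>, their members, and the members of those.\<close>
  obtain T where T: "T \<in> M" "\<And>z. z \<in> M \<Longrightarrow> E z T \<longleftrightarrow> z \<in> U \<union> V"
    using finite_set_exists[of "U \<union> V"] fin sub by auto
  obtain T1 where T1: "T1 \<in> M" "\<And>z. z \<in> M \<Longrightarrow> E z T1 \<longleftrightarrow> (\<exists>b\<in>M. E b T \<and> E z b)"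
    using union_exists[OF T(1)] by blast
  obtain T2 where T2: "T2 \<in> M" "\<And>z. z \<in> M \<Longrightarrow> E z T2 \<longleftrightarrow> (\<exists>b\<in>M. E b T1 \<and> E z b)"
    using union_exists[OF T1(1)] by blast
  obtain B where B: "B \<in> M" "\<And>z. z \<in> M \<Longrightarrow> E z B \<longleftrightarrow> E z T \<or> E z T1"
    using binary_union[OF T(1) T1(1)] by blast
  obtain D where D: "D \<in> M" "\<And>z. z \<in> M \<Longrightarrow> E z D \<longleftrightarrow> E z B \<or> E z T2"
    using binary_union[OF B(1) T2(1)] by blast
  obtain c where c: "c \<in> M" "\<not> E c D" "\<not> E c c" using Russell[OF D(1)] by blast
  \<comment> \<open>\<open>c0\<close> keeps \<open>c\<close> apart from the elements of
    \<open>V\<close>, \<open>c1\<close> keeps \<open>z\<close> out of \<open>U \<union> V\<close>,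
    and \<open>c2\<close> keeps \<open>z\<close> from being a member of anything there.\<close>
  have c0: "c \<notin> U \<union> V" and c1: "\<And>y. y \<in> U \<union> V \<Longrightarrow> \<not> E c y"
    and c2: "\<And>y z. y \<in> U \<union> V \<Longrightarrow> z \<in> M \<Longrightarrow> E c z \<Longrightarrow> \<not> E z y"
  proof -
    have nT: "\<not> E c T" and nT1: "\<not> E c T1" and nT2: "\<not> E c T2"
      using c(1,2) D(2) B(2) by simp_all
    show "c \<notin> U \<union> V" using nT T(2)[OF c(1)] by simp
    show "\<not> E c y" if "y \<in> U \<union> V" for y
    proof -
      have "y \<in> M" using that sub by blast
      then show ?thesis using nT1 T1(2)[OF c(1)] T(2) that by blast
    qed
    show "\<not> E z y" if "y \<in> U \<union> V" "z \<in> M" "E c z" for y z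
    proof -
      have "y \<in> M" using that(1) sub by blast
      moreover have "\<not> E z T1" using nT2 T2(2)[OF c(1)] that(2,3) by blast
      ultimately show ?thesis using T1(2)[OF that(2)] T(2) that(1) by blast
    qed
  qed
  obtain A where A: "A \<in> M" "\<And>z. z \<in> M \<Longrightarrow> E z A \<longleftrightarrow> z \<in> insert c U"
    using finite_set_exists[of "insert c U"] fin sub c(1) by auto
  \<comment> \<open>Without a loop \<open>A\<close> itself serves; with a loop, the AFA set
    \<open>z = {z} \<union> A\<close>.\<close>
  obtain z where z: "z \<in> M" "\<And>y. y \<in> M \<Longrightarrow> E y z \<longleftrightarrow> (l \<and> y = z) \<or> y \<in> insert c U"
    using self_member_exists[OF A(1)] A by (cases l) auto
  have cz: "E c z" using z c(1) by blast
  have zUV: "z \<notin> U \<union> V" using c1 cz by blast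
  \<comment> \<open>For false \<open>l\<close> a loop would put \<open>z\<close> into
    \<open>insert c U\<close>; but \<open>z = c\<close> contradicts \<open>E c z\<close> and
    \<open>\<not> E c c\<close>, and \<open>z\<close> is outside \<open>U\<close>.\<close>
  have zz: "E z z = l" using z zUV cz c(3) by auto
  show "\<exists>z\<in>M - (U \<union> V). (E z z \<or> E z z) = l \<and> (\<forall>u\<in>U. E z u \<or> E u z) \<and>
          (\<forall>v\<in>V. \<not> (E z v \<or> E v z))"
  proof (intro bexI conjI ballI)
    show "(E z z \<or> E z z) = l" using zz by simp
    show "E z u \<or> E u z" if "u \<in> U" for u using z(2) that sub by blast
    \<comment> \<open>A member \<open>v\<close> of \<open>z\<close> would be \<open>z\<close>,
      \<open>c\<close> or an element of \<open>U\<close>, all excluded for \<open>v\<close> in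
      \<open>V\<close>.\<close>
    show "\<not> (E z v \<or> E v z)" if "v \<in> V" for v
      using that z sub disj c0 c2[OF _ z(1) cz] zUV by blast
    show "z \<in> M - (U \<union> V)" using z(1) zUV by blast
  qed
qed

end

theorem theorem2:
  fixes M :: "'a set" and E :: "'a \<Rightarrow> 'a \<Rightarrow> bool"
  assumes "ZFA_model M E" and "countable M"
  shows "is_random_loopy_graph (membership_graph M E)"
  unfolding is_random_loopy_graph_def
proof (intro conjI)
  show lg: "loopy_graph (membership_graph M E)"
    unfolding loopy_graph_def membership_graph_def symp_on_def by auto
  show ct: "countable (verts (membership_graph M E))"
    using assms(2) unfolding membership_graph_def by simp
  \<comment> \<open>Edges are unordered pairs, so every outcome is symmetric, and back and forth
    applies to each outcome with the extension property.\<close>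
  have "loopy_graph (graph_of_flips \<omega>)" "countable (verts (graph_of_flips \<omega>))" for \<omega>
    unfolding loopy_graph_def graph_of_flips_def symp_on_def by (auto simp: insert_commute)
  then show "AE \<omega> in coin_flips. lgraph_iso (membership_graph M E) (graph_of_flips \<omega>)"
    using graph_of_flips_extension
      extension_property_iso[OF lg ct ZFA_model.membership_graph_extension[OF assms(1)]]
    by (auto elim: eventually_mono)
qed

end
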